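(* Let $\Phi=(A;\{E_i\}_{i=0}^d;A^*;\{E^*_i\}_{i=0}^d)$ be a sharp tridiagonal system on $V$ with eigenvalue sequence $\{\theta_i\}_{i=0}^d$, dual eigenvalue sequence $\{\theta^*_i\}_{i=0}^d$ and split sequence $\{\zeta_i\}_{i=0}^d$. Then (i), (ii) hold. (i) For $0\le i\le d$, $$\zeta_i=(\theta^*_0-\theta^*_1)(\theta^*_0-\theta^*_2)\cdots(\theta^*_0-\theta^*_i)\,\mathrm{tr}(\tau_i(A)E^*_0),$$ $$\zeta_i=(\theta_0-\theta_1)(\theta_0-\theta_2)\cdots(\theta_0-\theta_i)\,\mathrm{tr}(\tau^*_i(A^* )E_0).$$ (ii) For $0\le i\le d$, $$\zeta_i=\frac{\mathrm{tr}(E_0\tau^*_i(A^* )\tau_i(A)E^*_0)}{\mathrm{tr}(E_0E^*_0)},\qquad \zeta_i=\frac{\mathrm{tr}(E^*_0\tau_i(A)\tau^*_i(A^* )E_0)}{\mathrm{tr}(E^*_0E_0)}.$$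
   Context: $\mathbb{K}$ is a field and $V$ is a $\mathbb{K}$-vector space of finite positive dimension; $\mathrm{End}(V)$ is the algebra of $\mathbb{K}$-linear maps $V\to V$, with identity $I$; $\mathrm{tr}$ is the trace. "Diagonalizable" means $V$ is spanned by the eigenspaces. A tridiagonal pair on $V$ is an ordered pair $A,A^*\in\mathrm{End}(V)$ ($A^*$ is just a name, not an adjoint) such that: (i) each of $A,A^*$ is diagonalizable; (ii) there is an ordering $\{V_i\}_{i=0}^d$ of the eigenspaces of $A$ with $A^*V_i\subseteq V_{i-1}+V_i+V_{i+1}$ for $0\le i\le d$ (where $V_{-1}=V_{d+1}=0$); (iii) there is an ordering $\{V^*_i\}_{i=0}^\delta$ of the eigenspaces of $A^*$ with $AV^*_i\subseteq V^*_{i-1}+V^*_i+V^*_{i+1}$ for $0\le i\le\delta$ (where $V^*_{-1}=V^*_{\delta+1}=0$); (iv) no subspace $W$ with $0\ne W\ne V$ satisfies $AW\subseteq W$ and $A^*W\subseteq W$. Orderings as in (ii), (iii) are called standard. It is known that $d=\delta$ and that $V_i,V_{d-i},V^*_i,V^*_{d-i}$ all have the same dimension for $0\le i\le d$. A tridiagonal system on $V$ is a sequence $\Phi=(A;\{E_i\}_{i=0}^d;A^*;\{E^*_i\}_{i=0}^d)$ where $A,A^*$ is a tridiagonal pair on $V$ and $\{E_i\}$ (resp. $\{E^*_i\}$) are the primitive idempotents (projections onto the eigenspaces along the other eigenspaces) of $A$ (resp. $A^*$), ordered so that the eigenspaces $\{E_iV\}$ (resp. $\{E^*_iV\}$) are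 in a standard order. $\theta_i$ (resp. $\theta^*_i$) is the eigenvalue of $A$ (resp. $A^*$) on $E_iV$ (resp. $E^*_iV$); $\{\theta_i\}$ and $\{\theta_i^*\}$ are the eigenvalue sequence and dual eigenvalue sequence of $\Phi$. $\Phi$ is sharp if $\dim E_0V=1$ (equivalently $\dim E^*_0V=1$). When $\Phi$ is sharp, $\mathrm{tr}(E_0E_0^* )\neq 0$, so the quotients make sense. For an indeterminate $\lambda$ and $0\le i\le d$: $\tau_i=(\lambda-\theta_0)(\lambda-\theta_1)\cdots(\lambda-\theta_{i-1})$ and $\tau^*_i=(\lambda-\theta^*_0)(\lambda-\theta^*_1)\cdots(\lambda-\theta^*_{i-1})$. Split sequence: let $U_i=(E^*_0V+\cdots+E^*_iV)\cap(E_iV+\cdots+E_dV)$ for $0\le i\le d$. It is known that $V=U_0+\cdots+U_d$ is a direct sum, $U_0=E_0^*V$, $(A-\theta_iI)U_i\subseteq U_{i+1}$ and $(A^*-\theta^*_iI)U_i\subseteq U_{i-1}$ ($U_{-1}=U_{d+1}=0$). If $\Phi$ is sharp, $\dim U_0=1$ and $U_0$ is invariant under $(A^*-\theta^*_1I)(A^*-\theta^*_2I)\cdots(A^*-\theta^*_iI)(A-\theta_{i-1}I)\cdots(A-\theta_1I)(A-\theta_0I)$; the corresponding eigenvalue is $\zeta_i$, and $\{\zeta_i\}_{i=0}^d$ is the split sequence of $\Phi$. *)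

theory Defs
  imports Complex_Main "HOL-Computational_Algebra.Polynomial"
begin

definition tau :: "(nat \<Rightarrow> 'a::field) \<Rightarrow> nat \<Rightarrow> 'a poly" where
  "tau \<theta> i = (\<Prod>h<i. [:- \<theta> h, 1:])"

context finite_dimensional_vector_space
begin

definition eigenspace :: "('b \<Rightarrow> 'b) \<Rightarrow> 'a \<Rightarrow> 'b set" where
  "eigenspace A t = {v. A v = t *s v}"

definition eigenspaces :: "('b \<Rightarrow> 'b) \<Rightarrow> 'b set set" where
  "eigenspaces A = {eigenspace A t | t. eigenspace A t \<noteq> {0}}"

definition diagonalizable :: "('b \<Rightarrow> 'b) \<Rightarrow> bool" where
  "diagonalizable A \<longleftrightarrow> span (\<Union>(eigenspaces A)) = UNIV"

text \<open>A sum of subspaces is written as the span of their union. The index set below is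
  \<open>{i-1, i, i+1}\<close> intersected with \<open>{0..d}\<close>, so the out-of-range terms contribute nothing.\<close>

definition standard_ordering ::
  "('b \<Rightarrow> 'b) \<Rightarrow> ('b \<Rightarrow> 'b) \<Rightarrow> nat \<Rightarrow> (nat \<Rightarrow> 'b set) \<Rightarrow> bool" where
  "standard_ordering A B d W \<longleftrightarrow>
     bij_betw W {..d} (eigenspaces A) \<and>
     (\<forall>i\<le>d. B ` W i \<subseteq> span (\<Union>j\<in>{j. j \<le> d \<and> i \<le> j + 1 \<and> j \<le> i + 1}. W j))"

text \<open>A prime marks the dual objects: \<open>A'\<close>, \<open>E'\<close>, \<open>\<theta>'\<close> are usually written
  \<open>A\<^sup>*\<close>, \<open>E\<^sup>*\<close>, \<open>\<theta>\<^sup>*\<close>. Sequences indexed by \<open>0, \<dots>, d\<close> are functions on all of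
  \<open>nat\<close>; their values beyond \<open>d\<close> are arbitrary and irrelevant.\<close>

definition tridiagonal_pair :: "('b \<Rightarrow> 'b) \<Rightarrow> ('b \<Rightarrow> 'b) \<Rightarrow> bool" where
  "tridiagonal_pair A A' \<longleftrightarrow>
     Vector_Spaces.linear scale scale A \<and> Vector_Spaces.linear scale scale A' \<and>
     diagonalizable A \<and> diagonalizable A' \<and>
     (\<exists>d W. standard_ordering A A' d W) \<and>
     (\<exists>\<delta> W'. standard_ordering A' A \<delta> W') \<and>
     \<not> (\<exists>W. subspace W \<and> W \<noteq> {0} \<and> W \<noteq> UNIV \<and> A ` W \<subseteq> W \<and> A' ` W \<subseteq> W)"

definition primitive_idempotents :: "('b \<Rightarrow> 'b) \<Rightarrow> ('b \<Rightarrow> 'b) set" where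
  "primitive_idempotents A =
     {P. Vector_Spaces.linear scale scale P \<and>
         (\<exists>W\<in>eigenspaces A. (\<forall>v\<in>W. P v = v) \<and>
            (\<forall>W'\<in>eigenspaces A - {W}. \<forall>v\<in>W'. P v = 0))}"

definition tridiagonal_system ::
  "nat \<Rightarrow> ('b \<Rightarrow> 'b) \<Rightarrow> (nat \<Rightarrow> 'b \<Rightarrow> 'b) \<Rightarrow> ('b \<Rightarrow> 'b) \<Rightarrow> (nat \<Rightarrow> 'b \<Rightarrow> 'b) \<Rightarrow> bool" where
  "tridiagonal_system d A E A' E' \<longleftrightarrow>
     tridiagonal_pair A A' \<and>
     bij_betw E {..d} (primitive_idempotents A) \<and>
     bij_betw E' {..d} (primitive_idempotents A') \<and>
     standard_ordering A A' d (\<lambda>i. range (E i)) \<and>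
     standard_ordering A' A d (\<lambda>i. range (E' i))"

definition sharp :: "(nat \<Rightarrow> 'b \<Rightarrow> 'b) \<Rightarrow> bool" where
  "sharp E \<longleftrightarrow> dim (range (E 0)) = 1"

text \<open>The next definition is meaningful when \<open>A\<close> acts as a scalar on the nonzero subspace
  \<open>W\<close>; the scalar is then unique.\<close>

definition eigenvalue_on :: "('b \<Rightarrow> 'b) \<Rightarrow> 'b set \<Rightarrow> 'a" where
  "eigenvalue_on A W = (THE t. \<forall>v\<in>W. A v = t *s v)"

definition eigenvalue_seq :: "('b \<Rightarrow> 'b) \<Rightarrow> (nat \<Rightarrow> 'b \<Rightarrow> 'b) \<Rightarrow> nat \<Rightarrow> 'a" where
  "eigenvalue_seq A E i = eigenvalue_on A (range (E i))"

definition poly_endo :: "'a poly \<Rightarrow> ('b \<Rightarrow> 'b) \<Rightarrow> 'b \<Rightarrow> 'b" where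
  "poly_endo p A v = (\<Sum>k\<le>degree p. coeff p k *s (A ^^ k) v)"

definition split_space ::
  "nat \<Rightarrow> (nat \<Rightarrow> 'b \<Rightarrow> 'b) \<Rightarrow> (nat \<Rightarrow> 'b \<Rightarrow> 'b) \<Rightarrow> nat \<Rightarrow> 'b set" where
  "split_space d E E' i =
     span (\<Union>h\<in>{0..i}. range (E' h)) \<inter> span (\<Union>h\<in>{i..d}. range (E h))"

text \<open>\<open>shift_prod A \<theta> [h\<^sub>1, \<dots>, h\<^sub>n]\<close> is the product
  \<open>(A - \<theta> h\<^sub>1 I) \<cdots> (A - \<theta> h\<^sub>n I)\<close>, so the last factor is applied first.\<close>

definition shift_prod :: "('b \<Rightarrow> 'b) \<Rightarrow> (nat \<Rightarrow> 'a) \<Rightarrow> nat list \<Rightarrow> 'b \<Rightarrow> 'b" where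
  "shift_prod A \<theta> hs = foldr (\<lambda>h F. (\<lambda>v. A v - \<theta> h *s v) \<circ> F) hs id"

definition split_seq ::
  "nat \<Rightarrow> ('b \<Rightarrow> 'b) \<Rightarrow> (nat \<Rightarrow> 'b \<Rightarrow> 'b) \<Rightarrow> ('b \<Rightarrow> 'b) \<Rightarrow> (nat \<Rightarrow> 'b \<Rightarrow> 'b) \<Rightarrow> nat \<Rightarrow> 'a" where
  "split_seq d A E A' E' i =
     eigenvalue_on
       (shift_prod A' (eigenvalue_seq A' E') [1..<Suc i] \<circ>
        shift_prod A (eigenvalue_seq A E) (rev [0..<i]))
       (split_space d E E' 0)"

text \<open>\<open>Basis\<close> is the arbitrary basis fixed by the locale; the trace does not depend on it.\<close>

definition endo_trace :: "('b \<Rightarrow> 'b) \<Rightarrow> 'a" where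
  "endo_trace f = (\<Sum>b\<in>Basis. representation Basis (f b) b)"

end

end

theory Submission
  imports Defs
begin

text \<open>
  Write \<open>V\<^sub>i = E\<^sub>iV\<close> and \<open>V'\<^sub>i = E'\<^sub>iV\<close>. The subspace
  \<open>\<Sum>\<^sub>i (V'\<^sub>0 + \<dots> + V'\<^sub>i) \<inter> (V\<^sub>i\<^sub>+\<^sub>1 + \<dots> + V\<^sub>d)\<close> is invariant under \<open>A\<close> and
  \<open>A'\<close> and is contained in \<open>V\<^sub>1 + \<dots> + V\<^sub>d\<close>, so it vanishes by irreducibility. Hence \<open>E\<^sub>0\<close> is
  injective on \<open>V'\<^sub>0\<close> and, dually, \<open>E'\<^sub>0\<close> is injective on \<open>V\<^sub>0\<close>. With \<open>dim V\<^sub>0 = 1\<close> this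
  gives \<open>dim V'\<^sub>0 = 1\<close> and \<open>tr (E\<^sub>0E'\<^sub>0) \<noteq> 0\<close>.

  Put \<open>q = (\<lambda> - \<theta>'\<^sub>1) \<cdots> (\<lambda> - \<theta>'\<^sub>i)\<close>. As \<open>\<tau>\<^sub>i(A)V'\<^sub>0 \<subseteq> V'\<^sub>0 + \<dots> + V'\<^sub>i\<close>, the operator
  \<open>q(A')\<tau>\<^sub>i(A)\<close> acts on \<open>V'\<^sub>0\<close> as \<open>\<zeta>\<^sub>i = q(\<theta>'\<^sub>0) tr (\<tau>\<^sub>i(A)E'\<^sub>0)\<close>. Polynomials of degree
  less than \<open>i\<close> in \<open>A'\<close> satisfy \<open>E\<^sub>0 p(A') \<tau>\<^sub>i(A) = 0\<close> and \<open>\<tau>\<^sub>i(A) p(A') E\<^sub>0 = 0\<close>. The monic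
  polynomials \<open>\<tau>'\<^sub>i\<close> and \<open>q\<close> of degree \<open>i\<close> are therefore interchangeable in these positions,
  which yields both \<open>E\<^sub>0 \<tau>'\<^sub>i(A') \<tau>\<^sub>i(A) E'\<^sub>0 = \<zeta>\<^sub>i E\<^sub>0E'\<^sub>0\<close> and
  \<open>E'\<^sub>0 \<tau>\<^sub>i(A) \<tau>'\<^sub>i(A') E\<^sub>0 = \<zeta>\<^sub>i E'\<^sub>0E\<^sub>0\<close>. The second is the first one for the system with
  the roles of \<open>A\<close> and \<open>A'\<close> exchanged, so both systems have the same split sequence.
\<close>

section \<open>Polynomials in an endomorphism and rank-one traces\<close>

lemma degree_prod_linear_factors:
  fixes t :: "nat \<Rightarrow> 'a::field"
  assumes "finite I"
  shows "degree (\<Prod>h\<in>I. [:- t h, 1:]) = card I"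
  using assms by (subst degree_prod_eq_sum_degree) auto

lemma lead_coeff_prod_linear_factors:
  fixes t :: "nat \<Rightarrow> 'a::field"
  shows "lead_coeff (\<Prod>h\<in>I. [:- t h, 1:]) = 1"
  by (simp add: lead_coeff_prod)

lemma poly_prod_linear_factors:
  fixes t :: "nat \<Rightarrow> 'a::field"
  shows "poly (\<Prod>h\<in>I. [:- t h, 1:]) x = (\<Prod>h\<in>I. x - t h)"
  by (simp add: poly_prod)

context finite_dimensional_vector_space
begin

lemma subspace_eigenspace:
  assumes "Vector_Spaces.linear scale scale A"
  shows "subspace (eigenspace A t)"
proof -
  interpret A: Vector_Spaces.linear scale scale A by fact
  show ?thesis
    by (rule subspaceI)
      (auto simp: eigenspace_def A.zero A.add A.scale scale_right_distrib scale_left_commute)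
qed

text \<open>The nonzero vector \<open>w\<close> is what makes the scalar in the definite description
  unique.\<close>

lemma eigenvalue_on_eqI:
  assumes "\<And>v. v \<in> W \<Longrightarrow> A v = t *s v" "w \<in> W" "w \<noteq> 0"
  shows "eigenvalue_on A W = t"
  unfolding eigenvalue_on_def
proof (rule the_equality)
  show "\<forall>v\<in>W. A v = t *s v" using assms(1) by blast
  fix s assume "\<forall>v\<in>W. A v = s *s v"
  then have "s *s w = t *s w" using assms(1,2) by metis
  with assms(3) show "s = t" using scale_right_imp_eq by blast
qed

lemma linear_funpow:
  assumes "Vector_Spaces.linear scale scale A"
  shows "Vector_Spaces.linear scale scale (A ^^ n)"
proof (induction n)
  case 0
  show ?case by (simp only: funpow.simps module_hom_id)
next
  case (Suc n)
  then show ?case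
    using assms by (simp only: funpow.simps Vector_Spaces.linear_compose)
qed

lemma linear_poly_endo:
  assumes "Vector_Spaces.linear scale scale A"
  shows "Vector_Spaces.linear scale scale (poly_endo p A)"
proof -
  have "Vector_Spaces.linear scale scale (\<lambda>v. \<Sum>k\<le>degree p. coeff p k *s (A ^^ k) v)"
  proof -
    interpret vector_space_pair scale scale ..
    show ?thesis
      by (intro linear_compose_sum linear_compose_scale_right ballI linear_funpow assms)
  qed
  then show ?thesis
    by (simp add: poly_endo_def[abs_def])
qed

lemma span_image_subset_if_linear:
  assumes "Vector_Spaces.linear scale scale f" "\<And>v. v \<in> S \<Longrightarrow> f v \<in> span S"
  shows "f ` span S \<subseteq> span S"
proof -
  have "f ` span S = span (f ` S)"
    by (rule module_hom.span_image[OF module_hom_linearI[OF assms(1)], symmetric])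
  also have "\<dots> \<subseteq> span S"
    by (rule span_minimal) (use assms(2) in \<open>auto simp: subspace_span\<close>)
  finally show ?thesis .
qed

section \<open>Traces of rank-one maps\<close>

lemma endo_trace_rank_one:
  assumes "Vector_Spaces.linear scale (*) g"
  shows "endo_trace (\<lambda>v. g v *s y) = g y"
proof -
  interpret g: Vector_Spaces.linear scale "(*)" g by fact
  have "endo_trace (\<lambda>v. g v *s y) = (\<Sum>b\<in>Basis. g b * representation Basis y b)"
    by (simp add: endo_trace_def representation_scale[OF independent_Basis] span_Basis)
  also have "\<dots> = g (\<Sum>b\<in>Basis. representation Basis y b *s b)"
    by (simp add: g.sum g.scale mult.commute)
  also have "\<dots> = g y"
    by (subst sum_representation_eq[OF independent_Basis])
      (auto simp: span_Basis finite_Basis)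
  finally show ?thesis .
qed

lemma endo_trace_scale:
  "endo_trace (\<lambda>v. c *s f v) = c * endo_trace f"
  by (simp add: endo_trace_def representation_scale[OF independent_Basis] span_Basis
      sum_distrib_left)

text \<open>Since \<open>u \<noteq> 0\<close> and \<open>P u = u\<close>, the functional satisfies
  \<open>g u = 1\<close>, so \<open>P\<close> is an idempotent of rank one. Keeping \<open>g\<close>
  explicit lets traces be read off as its values.\<close>

definition rank_one_projection :: "('b \<Rightarrow> 'b) \<Rightarrow> bool" where
  "rank_one_projection P \<longleftrightarrow>
     (\<exists>u g. u \<noteq> 0 \<and> P u = u \<and> Vector_Spaces.linear scale (*) g \<and> (\<forall>v. P v = g v *s u))"

lemma rank_one_projectionI:
  assumes P: "Vector_Spaces.linear scale scale P" and "u \<noteq> 0" "P u = u" "\<And>v. \<exists>c. P v = c *s u"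
  shows "rank_one_projection P"
proof -
  interpret P: Vector_Spaces.linear scale scale P by (rule P)
  from assms(4) obtain g where g: "P v = g v *s u" for v by metis
  have "g (x + y) = g x + g y" for x y
  proof -
    have "g (x + y) *s u = (g x + g y) *s u"
      by (metis P.add g scale_left_distrib)
    with \<open>u \<noteq> 0\<close> show ?thesis using scale_right_imp_eq by blast
  qed
  moreover have "g (c *s x) = c * g x" for c x
  proof -
    have "g (c *s x) *s u = (c * g x) *s u"
      by (metis P.scale g scale_scale)
    with \<open>u \<noteq> 0\<close> show ?thesis using scale_right_imp_eq by blast
  qed
  ultimately have "Vector_Spaces.linear scale (*) g"
    by unfold_locales (auto simp: algebra_simps)
  with assms g show ?thesis unfolding rank_one_projection_def by blast
qed

text \<open>With \<open>P = g(-) u\<close>, both sides equal \<open>g v * g (X u)\<close> times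
  \<open>u\<close>. This is the bridge between traces and operator identities.\<close>

lemma rank_one_compression:
  assumes P: "rank_one_projection P" and X: "Vector_Spaces.linear scale scale X"
  shows "P (X (P v)) = endo_trace (X \<circ> P) *s P v"
proof -
  interpret X: Vector_Spaces.linear scale scale X by (rule X)
  from P obtain u g where g: "Vector_Spaces.linear scale (*) g" "\<And>v. P v = g v *s u"
    unfolding rank_one_projection_def by blast
  interpret g: Vector_Spaces.linear scale "(*)" g by (rule g(1))
  have "X \<circ> P = (\<lambda>v. g v *s X u)" by (auto simp: g(2) X.scale)
  then have "endo_trace (X \<circ> P) = g (X u)" by (simp add: endo_trace_rank_one[OF g(1)])
  then show ?thesis by (simp add: g(2) X.scale g.scale mult.commute)
qed

lemma dim_1_generator:
  assumes "subspace W" "dim W = 1"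
  obtains u where "u \<noteq> 0" "u \<in> W" "\<And>w. w \<in> W \<Longrightarrow> \<exists>c. w = c *s u"
proof -
  obtain B where B: "B \<subseteq> W" "independent B" "W \<subseteq> span B" "card B = dim W"
    using basis_exists by blast
  then obtain u where u: "B = {u}" using assms(2) by (metis card_1_singletonE)
  show ?thesis
  proof
    show "u \<noteq> 0" using B(2) u by (auto simp: dependent_zero)
    show "u \<in> W" using B u by auto
    show "\<exists>c. w = c *s u" if "w \<in> W" for w
      using B(3) that u by (auto simp: span_singleton)
  qed
qed

end

section \<open>Spectral resolutions and tridiagonal decompositions\<close>

text \<open>Eigenspaces enter only through a complete system of orthogonal idempotents, so
  identities between operators are verified one component at a time.\<close>

locale spectral_resolution = finite_dimensional_vector_space scale Basis
  for scale :: "'a::field \<Rightarrow> 'b::ab_group_add \<Rightarrow> 'b" (infixr "*s" 75) and Basis +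
  fixes d :: nat and A :: "'b \<Rightarrow> 'b" and E :: "nat \<Rightarrow> 'b \<Rightarrow> 'b" and \<theta> :: "nat \<Rightarrow> 'a"
  assumes linear_A: "Vector_Spaces.linear scale scale A"
    and linear_E: "i \<le> d \<Longrightarrow> Vector_Spaces.linear scale scale (E i)"
    and E_E: "i \<le> d \<Longrightarrow> j \<le> d \<Longrightarrow> E i (E j v) = (if i = j then E i v else 0)"
    and sum_E: "(\<Sum>i\<le>d. E i v) = v"
    and A_E: "i \<le> d \<Longrightarrow> A (E i v) = \<theta> i *s E i v"
begin

lemmas E_linear_simps =
  module_hom.zero[OF module_hom_linearI[OF linear_E]]
  module_hom.add[OF module_hom_linearI[OF linear_E]]
  module_hom.diff[OF module_hom_linearI[OF linear_E]]
  module_hom.scale[OF module_hom_linearI[OF linear_E]]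
  module_hom.sum[OF module_hom_linearI[OF linear_E]]

lemma eq_if_components_eq:
  assumes "\<And>i. i \<le> d \<Longrightarrow> E i x = E i y"
  shows "x = y"
  by (metis (no_types, lifting) assms atMost_iff sum.cong sum_E)

lemma E_A: "i \<le> d \<Longrightarrow> E i (A v) = \<theta> i *s E i v"
proof -
  assume i: "i \<le> d"
  have "A v = (\<Sum>j\<le>d. A (E j v))"
    by (metis (no_types) sum_E module_hom.sum[OF module_hom_linearI[OF linear_A]])
  also have "\<dots> = (\<Sum>j\<le>d. \<theta> j *s E j v)"
    by (simp add: A_E)
  finally have "E i (A v) = (\<Sum>j\<le>d. \<theta> j *s E i (E j v))"
    using i by (simp add: E_linear_simps)
  also have "\<dots> = (\<Sum>j\<le>d. if j = i then \<theta> j *s E i v else 0)"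
    using i by (intro sum.cong) (auto simp: E_E)
  finally show ?thesis using i by simp
qed

lemma E_funpow: "i \<le> d \<Longrightarrow> E i ((A ^^ n) v) = \<theta> i ^ n *s E i v"
  by (induction n) (auto simp: E_A)

lemma E_poly_endo: "i \<le> d \<Longrightarrow> E i (poly_endo p A v) = poly p (\<theta> i) *s E i v"
  by (simp add: poly_endo_def E_linear_simps E_funpow poly_altdef scale_sum_left)

lemma E_shift_prod:
  "i \<le> d \<Longrightarrow> E i (shift_prod A \<theta> hs v) = (\<Prod>h\<leftarrow>hs. \<theta> i - \<theta> h) *s E i v"
  by (induction hs)
    (auto simp: shift_prod_def E_linear_simps E_A scale_left_diff_distrib left_diff_distrib)

text \<open>Both sides multiply each component \<open>E i v\<close> by the same scalar; distinctness
  turns the product over the list into one over its set.\<close>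

lemma shift_prod_eq_poly_endo:
  assumes "distinct hs"
  shows "shift_prod A \<theta> hs v = poly_endo (\<Prod>h\<in>set hs. [:- \<theta> h, 1:]) A v"
  by (rule eq_if_components_eq)
    (simp add: E_shift_prod E_poly_endo poly_prod_linear_factors assms
      flip: prod.distinct_set_conv_list)

end

locale tridiagonal_decomposition =
  spectral_resolution scale Basis d A E \<theta> +
  dual: spectral_resolution scale Basis d A' E' \<theta>'
  for scale :: "'a::field \<Rightarrow> 'b::ab_group_add \<Rightarrow> 'b" (infixr "*s" 75) and Basis
    and d A E A' E' \<theta> \<theta>' +
  assumes E_A'_E: "i \<le> d \<Longrightarrow> j \<le> d \<Longrightarrow> i + 1 < j \<or> j + 1 < i \<Longrightarrow> E i (A' (E j v)) = 0"
    and E'_A_E': "i \<le> d \<Longrightarrow> j \<le> d \<Longrightarrow> i + 1 < j \<or> j + 1 < i \<Longrightarrow> E' i (A (E' j v)) = 0"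
    and irreducible: "subspace W \<Longrightarrow> A ` W \<subseteq> W \<Longrightarrow> A' ` W \<subseteq> W \<Longrightarrow> W = {0} \<or> W = UNIV"
    and E_0_nonzero: "\<exists>v. E 0 v \<noteq> 0"
    and E'_0_nonzero: "\<exists>v. E' 0 v \<noteq> 0"
begin

text \<open>The axioms are symmetric, so every fact of this locale also holds with the roles of
  \<open>A\<close> and \<open>A'\<close> exchanged.\<close>

lemma swap: "tridiagonal_decomposition scale Basis d A' E' A E \<theta>' \<theta>"
  by unfold_locales (use E_A'_E E'_A_E' irreducible E_0_nonzero E'_0_nonzero in auto)

section \<open>How far powers of one map can shift the components of the other\<close>

lemma E_A'_eq_0:
  assumes "i \<le> d" "\<And>k. k \<le> d \<Longrightarrow> k \<le> i + 1 \<Longrightarrow> i \<le> k + 1 \<Longrightarrow> E k v = 0"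
  shows "E i (A' v) = 0"
proof -
  have z: "A' 0 = 0"
    by (rule module_hom.zero[OF module_hom_linearI[OF dual.linear_A]])
  have "A' v = (\<Sum>j\<le>d. A' (E j v))"
    by (metis (no_types) sum_E module_hom.sum[OF module_hom_linearI[OF dual.linear_A]])
  then have "E i (A' v) = (\<Sum>j\<le>d. E i (A' (E j v)))"
    using assms(1) by (simp add: E_linear_simps)
  also have "\<dots> = (\<Sum>j\<le>d. 0)"
  proof (intro sum.cong refl)
    fix j assume "j \<in> {..d}"
    then show "E i (A' (E j v)) = 0"
      using assms(1) assms(2)[of j] E_A'_E[of i j v] z
      by (cases "i + 1 < j \<or> j + 1 < i") (auto simp: E_linear_simps not_less)
  qed
  finally show ?thesis by simp
qed

text \<open>Each application of \<open>A'\<close> moves the lowest nonzero component down by at most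
  one index.\<close>

lemma E_funpow_A'_below:
  assumes "\<And>k. k \<le> d \<Longrightarrow> k < j \<Longrightarrow> E k v = 0" "k \<le> d" "k + n < j"
  shows "E k ((A' ^^ n) v) = 0"
  using assms(2,3)
proof (induction n arbitrary: k)
  case 0
  then show ?case using assms(1) by auto
next
  case (Suc n)
  then show ?case by (auto intro!: E_A'_eq_0)
qed

lemma E_funpow_A'_above:
  assumes "\<And>k. k \<le> d \<Longrightarrow> j < k \<Longrightarrow> E k v = 0" "k \<le> d" "j + n < k"
  shows "E k ((A' ^^ n) v) = 0"
  using assms(2,3)
proof (induction n arbitrary: k)
  case 0
  then show ?case using assms(1) by auto
next
  case (Suc n)
  then show ?case by (auto intro!: E_A'_eq_0)
qed

lemma E_poly_endo_A'_above:
  assumes "\<And>k. k \<le> d \<Longrightarrow> j < k \<Longrightarrow> E k v = 0" "k \<le> d" "j + degree p < k"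
  shows "E k (poly_endo p A' v) = 0"
proof -
  have "E k ((A' ^^ n) v) = 0" if "n \<le> degree p" for n
    using E_funpow_A'_above[OF assms(1,2)] assms(3) that by auto
  then show ?thesis
    using assms(2) by (simp add: poly_endo_def E_linear_simps)
qed

text \<open>From components of index at least \<open>degree p\<close>, only the leading term reaches
  index 0. Hence monic polynomials of equal degree are interchangeable under
  \<open>E 0\<close>.\<close>

lemma E_0_poly_endo_A':
  assumes "\<And>k. k \<le> d \<Longrightarrow> k < degree p \<Longrightarrow> E k v = 0" "lead_coeff p = 1"
  shows "E 0 (poly_endo p A' v) = E 0 ((A' ^^ degree p) v)"
proof -
  have "E 0 ((A' ^^ n) v) = 0" if "n < degree p" for n
    using E_funpow_A'_below[where j = "degree p"] assms(1) that by auto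
  then have "(\<Sum>n\<le>degree p. coeff p n *s E 0 ((A' ^^ n) v)) =
      (\<Sum>n\<le>degree p. if n = degree p then E 0 ((A' ^^ n) v) else 0)"
    using assms(2) by (intro sum.cong) auto
  then show ?thesis by (simp add: poly_endo_def E_linear_simps)
qed

text \<open>For \<open>n < degree q\<close>, the vector \<open>(A' ^^ n) (E 0 v)\<close> only has
  components of index at most \<open>n\<close>, all killed by \<open>p(A)\<close>. So again only the
  degree of the monic \<open>q\<close> matters.\<close>

lemma poly_endo_poly_endo_E_0:
  assumes "\<And>k. k \<le> d \<Longrightarrow> k < degree q \<Longrightarrow> poly p (\<theta> k) = 0" "lead_coeff q = 1"
  shows "poly_endo p A (poly_endo q A' (E 0 v)) = poly_endo p A ((A' ^^ degree q) (E 0 v))"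
proof -
  interpret P: Vector_Spaces.linear scale scale "poly_endo p A"
    by (rule linear_poly_endo[OF linear_A])
  have "poly_endo p A ((A' ^^ n) (E 0 v)) = 0" if n: "n < degree q" for n
  proof (rule eq_if_components_eq)
    fix k assume k: "k \<le> d"
    have "E k ((A' ^^ n) (E 0 v)) = 0" if "n < k"
      using E_funpow_A'_above[where j = 0 and n = n] k that by (auto simp: E_E)
    then show "E k (poly_endo p A ((A' ^^ n) (E 0 v))) = E k 0"
      using k n assms(1)[of k] by (cases "n < k") (auto simp: E_poly_endo E_linear_simps)
  qed
  then have "(\<Sum>n\<le>degree q. coeff q n *s poly_endo p A ((A' ^^ n) (E 0 v))) =
      (\<Sum>n\<le>degree q. if n = degree q then poly_endo p A ((A' ^^ n) (E 0 v)) else 0)"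
    using assms(2) by (intro sum.cong) auto
  then show ?thesis
    by (simp add: poly_endo_def[of q] P.sum P.scale)
qed

section \<open>The invariant subspace and the injectivity it yields\<close>

text \<open>The subspace \<open>(E'\<^sub>0V + \<dots> + E'\<^sub>iV) \<inter> (E\<^sub>i\<^sub>+\<^sub>1V + \<dots> + E\<^sub>dV)\<close>.\<close>

definition offdiag :: "nat \<Rightarrow> 'b set" where
  "offdiag i = {v. (\<forall>k\<le>d. i < k \<longrightarrow> E' k v = 0) \<and> (\<forall>k\<le>d. k \<le> i \<longrightarrow> E k v = 0)}"

lemma A_offdiag:
  assumes "i < d" "v \<in> offdiag i"
  shows "A v \<in> span (\<Union>i<d. offdiag i)"
proof -
  \<comment> \<open>The shift removes the component of index \<open>i + 1\<close>, while
    \<open>A\<close> raises the dual index by at most one, so \<open>y\<close> moves on to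
    \<open>offdiag (i + 1)\<close>.\<close>
  define y where "y = A v - \<theta> (i + 1) *s v"
  have y: "y \<in> offdiag (i + 1)"
    unfolding offdiag_def
  proof (intro CollectI conjI allI impI)
    fix k assume k: "k \<le> d" "i + 1 < k"
    then have "E' k (A v) = 0"
      using assms(2)
      by (intro tridiagonal_decomposition.E_A'_eq_0[OF swap]) (auto simp: offdiag_def)
    moreover have "E' k v = 0" using assms(2) k by (simp add: offdiag_def)
    ultimately show "E' k y = 0" using k by (simp add: y_def dual.E_linear_simps)
  next
    fix k assume k: "k \<le> d" "k \<le> i + 1"
    then have "k = i + 1 \<or> E k v = 0" using assms(2) by (auto simp: offdiag_def)
    then show "E k y = 0" using k by (auto simp: y_def E_linear_simps E_A)
  qed
  have "y \<in> span (\<Union>i<d. offdiag i)"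
  proof (cases "i + 1 < d")
    case True
    then show ?thesis using y by (intro span_base UN_I[of "i + 1"]) auto
  next
    \<comment> \<open>Here \<open>i + 1 = d\<close>, and membership in \<open>offdiag d\<close>
      makes every component vanish.\<close>
    case False
    then have "E k y = 0" if "k \<le> d" for k
      using y assms(1) that by (simp add: offdiag_def)
    then have "y = 0"
      by - (rule eq_if_components_eq, simp add: E_linear_simps)
    then show ?thesis by (simp add: span_zero)
  qed
  moreover have "v \<in> span (\<Union>i<d. offdiag i)"
    using assms by (intro span_base UN_I[of i]) auto
  moreover have "A v = \<theta> (i + 1) *s v + y" by (simp add: y_def)
  ultimately show ?thesis by (simp add: span_add span_scale)
qed

lemma A'_offdiag:
  assumes "i < d" "v \<in> offdiag i"
  shows "A' v \<in> span (\<Union>i<d. offdiag i)"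
proof -
  \<comment> \<open>Now the top dual component is removed, so \<open>y\<close> moves back to
    \<open>offdiag (i - 1)\<close>, or is zero if \<open>i = 0\<close>.\<close>
  define y where "y = A' v - \<theta>' i *s v"
  have y': "E' k y = 0" if "k \<le> d" "i \<le> k" for k
    using that assms by (cases "i = k") (auto simp: offdiag_def y_def dual.E_linear_simps dual.E_A)
  have y: "E k y = 0" if "k \<le> d" "k < i" for k
    using that assms E_A'_eq_0[of k v] by (auto simp: offdiag_def y_def E_linear_simps)
  have "y \<in> span (\<Union>i<d. offdiag i)"
  proof (cases i)
    case (Suc j)
    then have "y \<in> offdiag j" using y y' by (simp add: offdiag_def less_Suc_eq_le Suc_le_eq)
    then show ?thesis using Suc assms(1) by (intro span_base UN_I[of j]) auto
  next
    case 0
    with y' have "y = 0"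
      by - (rule dual.eq_if_components_eq, simp add: dual.E_linear_simps)
    then show ?thesis by (simp add: span_zero)
  qed
  moreover have "v \<in> span (\<Union>i<d. offdiag i)"
    using assms by (intro span_base UN_I[of i]) auto
  moreover have "A' v = \<theta>' i *s v + y" by (simp add: y_def)
  ultimately show ?thesis by (simp add: span_add span_scale)
qed

lemma span_offdiag: "span (\<Union>i<d. offdiag i) = {0}"
proof -
  let ?S = "\<Union>i<d. offdiag i"
  interpret E0: Vector_Spaces.linear scale scale "E 0"
    by (rule linear_E) simp
  have "E 0 v = 0" if "v \<in> ?S" for v
    using that by (auto simp: offdiag_def)
  then have "E 0 v = 0" if "v \<in> span ?S" for v
    using E0.eq_0_on_span that by blast
  then have "span ?S \<noteq> UNIV" using E_0_nonzero by blast
  moreover have "A ` span ?S \<subseteq> span ?S"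
    by (rule span_image_subset_if_linear[OF linear_A]) (auto intro: A_offdiag)
  moreover have "A' ` span ?S \<subseteq> span ?S"
    by (rule span_image_subset_if_linear[OF dual.linear_A]) (auto intro: A'_offdiag)
  ultimately show ?thesis using irreducible[OF subspace_span] by blast
qed

text \<open>For \<open>d > 0\<close>, a vector of \<open>range (E' 0)\<close> killed by
  \<open>E 0\<close> lies in \<open>offdiag 0\<close>, which is trivial; for \<open>d = 0\<close>,
  the map \<open>E 0\<close> is the identity.\<close>

lemma E'_0_eq_0_if_E_0_E'_0_eq_0:
  assumes "E 0 (E' 0 v) = 0"
  shows "E' 0 v = 0"
proof (cases "d = 0")
  case True
  then show ?thesis using assms sum_E[of "E' 0 v"] by simp
next
  case False
  then have "E' 0 v \<in> offdiag 0" using assms by (auto simp: offdiag_def dual.E_E)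
  then have "E' 0 v \<in> span (\<Union>i<d. offdiag i)"
    using False by (intro span_base UN_I[of 0]) auto
  then show ?thesis by (simp add: span_offdiag)
qed

section \<open>Products of polynomials in \<open>A\<close> and \<open>A'\<close> around
  \<open>E 0\<close> and \<open>E' 0\<close>\<close>

context
  fixes i :: nat and z :: 'a
  assumes i: "i \<le> d"
    and z: "\<And>v. (\<Prod>h=1..i. \<theta>' 0 - \<theta>' h) *s E' 0 (poly_endo (tau \<theta> i) A (E' 0 v)) = z *s E' 0 v"
begin

text \<open>Compare dual components: those above \<open>i\<close> are out of reach of
  \<open>tau \<theta> i\<close> in \<open>A\<close>, those from 1 to \<open>i\<close> are killed by
  roots of the left factor, and index 0 is the assumption on \<open>z\<close>.\<close>

lemma split_product_E'_0:
  "poly_endo (\<Prod>h=1..i. [:- \<theta>' h, 1:]) A' (poly_endo (tau \<theta> i) A (E' 0 v)) = z *s E' 0 v"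
  (is "poly_endo ?q A' ?x = _")
proof (rule dual.eq_if_components_eq)
  fix k assume k: "k \<le> d"
  have "E' k ?x = 0" if "i < k"
    using tridiagonal_decomposition.E_poly_endo_A'_above[OF swap, of 0 "E' 0 v" k "tau \<theta> i"] that k
    by (simp add: tau_def degree_prod_linear_factors dual.E_E)
  moreover have "(\<Prod>h=1..i. \<theta>' k - \<theta>' h) = 0" if "0 < k" "k \<le> i"
    using that by auto
  ultimately show "E' k (poly_endo ?q A' ?x) = E' k (z *s E' 0 v)"
    using k z[of v]
    by (cases "k = 0"; cases "i < k")
      (auto simp: dual.E_poly_endo dual.E_linear_simps dual.E_E poly_prod_linear_factors)
qed

lemma E_0_tau'_tau_E'_0:
  "E 0 (poly_endo (tau \<theta>' i) A' (poly_endo (tau \<theta> i) A (E' 0 v))) = z *s E 0 (E' 0 v)"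
proof -
  let ?q = "\<Prod>h=1..i. [:- \<theta>' h, 1:]" and ?x = "poly_endo (tau \<theta> i) A (E' 0 v)"
  \<comment> \<open>The roots of \<open>tau \<theta> i\<close> clear the components below
    \<open>i\<close>, which permits replacing \<open>tau \<theta>' i\<close> by
    \<open>?q\<close>.\<close>
  have x: "E k ?x = 0" if "k \<le> d" "k < i" for k
    using that by (auto simp: E_poly_endo tau_def poly_prod_linear_factors)
  have "E 0 (poly_endo (tau \<theta>' i) A' ?x) = E 0 ((A' ^^ i) ?x)"
    using E_0_poly_endo_A'[of "tau \<theta>' i" ?x] x lead_coeff_prod_linear_factors[of \<theta>' "{..<i}"]
    by (simp add: tau_def degree_prod_linear_factors)
  also have "\<dots> = E 0 (poly_endo ?q A' ?x)"
    using E_0_poly_endo_A'[of ?q ?x] x lead_coeff_prod_linear_factors[of \<theta>' "{1..i}"]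
    by (simp add: degree_prod_linear_factors)
  finally show ?thesis by (simp only: split_product_E'_0) (simp add: E_linear_simps)
qed

lemma E'_0_tau_tau'_E_0:
  "E' 0 (poly_endo (tau \<theta> i) A (poly_endo (tau \<theta>' i) A' (E 0 v))) = z *s E' 0 (E 0 v)"
proof -
  let ?q = "\<Prod>h=1..i. [:- \<theta>' h, 1:]"
  let ?y = "poly_endo ?q A' (E 0 v)"
  interpret P: Vector_Spaces.linear scale scale "poly_endo (tau \<theta> i) A"
    by (rule linear_poly_endo[OF linear_A])
  have tau: "poly (tau \<theta> i) (\<theta> k) = 0" if "k < i" for k
    using that by (auto simp: tau_def poly_prod_linear_factors)
  have "poly_endo (tau \<theta> i) A (poly_endo (tau \<theta>' i) A' (E 0 v)) =
      poly_endo (tau \<theta> i) A ((A' ^^ i) (E 0 v))"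
    using poly_endo_poly_endo_E_0[of "tau \<theta>' i" "tau \<theta> i" v] tau
      lead_coeff_prod_linear_factors[of \<theta>' "{..<i}"]
    by (simp add: tau_def[of \<theta>'] degree_prod_linear_factors)
  also have "\<dots> = poly_endo (tau \<theta> i) A ?y"
    using poly_endo_poly_endo_E_0[of ?q "tau \<theta> i" v] tau
      lead_coeff_prod_linear_factors[of \<theta>' "{1..i}"]
    by (simp add: degree_prod_linear_factors)
  \<comment> \<open>The dual resolution of the identity is inserted between the two polynomials.
    Only \<open>k = 0\<close> survives: \<open>?q\<close> kills \<open>0 < k \<le> i\<close>, and
    degree \<open>i\<close> in \<open>A\<close> cannot bring \<open>k > i\<close> down to 0.\<close>
  finally have "E' 0 (poly_endo (tau \<theta> i) A (poly_endo (tau \<theta>' i) A' (E 0 v))) =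
      E' 0 (poly_endo (tau \<theta> i) A (\<Sum>k\<le>d. E' k ?y))"
    by (simp add: dual.sum_E)
  also have "\<dots> = (\<Sum>k\<le>d. E' 0 (poly_endo (tau \<theta> i) A (E' k ?y)))"
    by (simp add: P.sum dual.E_linear_simps)
  also have "\<dots> = (\<Sum>k\<le>d. if k = 0 then E' 0 (poly_endo (tau \<theta> i) A (E' k ?y)) else 0)"
  proof (intro sum.cong refl)
    fix k assume k: "k \<in> {..d}"
    have "E' 0 (poly_endo (tau \<theta> i) A (E' k ?y)) = 0" if "0 < k" "k \<le> i"
    proof -
      have "E' k ?y = 0"
        using k that by (auto simp: dual.E_poly_endo poly_prod_linear_factors)
      then show ?thesis by (simp add: P.zero dual.E_linear_simps)
    qed
    moreover have "E' 0 (poly_endo (tau \<theta> i) A (E' k ?y)) = 0" if "i < k"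
    proof -
      have "E' 0 ((A ^^ n) (E' k ?y)) = 0" if "n \<le> i" for n
        using tridiagonal_decomposition.E_funpow_A'_below[OF swap, of k "E' k ?y" 0 n]
          k that \<open>i < k\<close> by (auto simp: dual.E_E)
      then show ?thesis
        by (simp add: poly_endo_def tau_def degree_prod_linear_factors dual.E_linear_simps)
    qed
    ultimately show "E' 0 (poly_endo (tau \<theta> i) A (E' k ?y)) =
        (if k = 0 then E' 0 (poly_endo (tau \<theta> i) A (E' k ?y)) else 0)"
      by (cases "i < k") auto
  qed
  also have "\<dots> = E' 0 (poly_endo (tau \<theta> i) A (E' 0 ?y))" by simp
  also have "\<dots> = z *s E' 0 (E 0 v)"
    using z[of "E 0 v"]
    by (simp add: dual.E_poly_endo poly_prod_linear_factors P.scale dual.E_linear_simps)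
  finally show ?thesis .
qed

end

section \<open>Rank one on the dual side and the nonzero denominators\<close>

lemma rank_one_E'_0:
  assumes "rank_one_projection (E 0)"
  shows "rank_one_projection (E' 0)"
proof -
  interpret E0: Vector_Spaces.linear scale scale "E 0"
    by (rule linear_E) simp
  from assms obtain u g where g: "\<And>v. E 0 v = g v *s u"
    unfolding rank_one_projection_def by blast
  from E'_0_nonzero obtain w where w: "E' 0 w \<noteq> 0" by blast
  let ?x = "E' 0 w"
  from w E'_0_eq_0_if_E_0_E'_0_eq_0[of w] have "g ?x \<noteq> 0" by (auto simp: g)
  show ?thesis
  proof (rule rank_one_projectionI)
    show "Vector_Spaces.linear scale scale (E' 0)" by (rule dual.linear_E) simp
    show "?x \<noteq> 0" by (rule w)
    show "E' 0 ?x = ?x" by (simp add: dual.E_E)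
    fix v
    \<comment> \<open>Chosen so that \<open>E 0\<close> kills \<open>E' 0 (v - ?c *s w)\<close>;
      injectivity then puts \<open>E' 0 v\<close> on the line through \<open>?x\<close>.\<close>
    let ?c = "g (E' 0 v) / g ?x"
    have "E 0 (E' 0 (v - ?c *s w)) = 0"
      using \<open>g ?x \<noteq> 0\<close> by (simp add: dual.E_linear_simps E0.diff E0.scale) (simp add: g)
    then have "E' 0 (v - ?c *s w) = 0" by (rule E'_0_eq_0_if_E_0_E'_0_eq_0)
    then have "E' 0 v = ?c *s ?x" by (simp add: dual.E_linear_simps)
    then show "\<exists>c. E' 0 v = c *s ?x" ..
  qed
qed

text \<open>A zero trace would give \<open>E' 0 \<circ> E 0 \<circ> E' 0 = 0\<close> by compression;
  applying injectivity on each side in turn then forces \<open>E' 0 = 0\<close>.\<close>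

lemma endo_trace_E_0_E'_0:
  assumes "rank_one_projection (E' 0)"
  shows "endo_trace (E 0 \<circ> E' 0) \<noteq> 0"
proof
  assume "endo_trace (E 0 \<circ> E' 0) = 0"
  then have "E' 0 (E 0 (E' 0 v)) = 0" for v
    using rank_one_compression[OF assms linear_E[of 0]] by simp
  then have "E 0 (E' 0 v) = 0" for v
    by (rule tridiagonal_decomposition.E'_0_eq_0_if_E_0_E'_0_eq_0[OF swap])
  then have "E' 0 v = 0" for v
    by (rule E'_0_eq_0_if_E_0_E'_0_eq_0)
  with E'_0_nonzero show False by blast
qed

section \<open>Trace formulas for the split values\<close>

abbreviation split_value :: "nat \<Rightarrow> 'a" where
  "split_value i \<equiv> (\<Prod>h=1..i. \<theta>' 0 - \<theta>' h) * endo_trace (poly_endo (tau \<theta> i) A \<circ> E' 0)"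

text \<open>Supplies the assumption on \<open>z\<close> made above, with
  \<open>split_value i\<close> as \<open>z\<close>.\<close>

lemma split_value_compression:
  assumes "rank_one_projection (E' 0)"
  shows "(\<Prod>h=1..i. \<theta>' 0 - \<theta>' h) *s E' 0 (poly_endo (tau \<theta> i) A (E' 0 v)) =
    split_value i *s E' 0 v"
  by (simp add: rank_one_compression[OF assms linear_poly_endo[OF linear_A]])

lemma split_value_eq_endo_trace_quotients:
  assumes "i \<le> d" "rank_one_projection (E 0)"
  shows "split_value i =
      endo_trace (E 0 \<circ> poly_endo (tau \<theta>' i) A' \<circ> poly_endo (tau \<theta> i) A \<circ> E' 0) /
      endo_trace (E 0 \<circ> E' 0)" (is ?first)
    and "split_value i =
      endo_trace (E' 0 \<circ> poly_endo (tau \<theta> i) A \<circ> poly_endo (tau \<theta>' i) A' \<circ> E 0) /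
      endo_trace (E' 0 \<circ> E 0)" (is ?second)
proof -
  note r' = rank_one_E'_0[OF assms(2)]
  have "E 0 \<circ> poly_endo (tau \<theta>' i) A' \<circ> poly_endo (tau \<theta> i) A \<circ> E' 0 =
      (\<lambda>v. split_value i *s (E 0 \<circ> E' 0) v)"
    using E_0_tau'_tau_E'_0[OF assms(1) split_value_compression[OF r']] by (simp add: fun_eq_iff)
  then show ?first
    using endo_trace_E_0_E'_0[OF r'] by (simp add: endo_trace_scale del: o_apply)
  have "E' 0 \<circ> poly_endo (tau \<theta> i) A \<circ> poly_endo (tau \<theta>' i) A' \<circ> E 0 =
      (\<lambda>v. split_value i *s (E' 0 \<circ> E 0) v)"
    using E'_0_tau_tau'_E_0[OF assms(1) split_value_compression[OF r']] by (simp add: fun_eq_iff)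
  then show ?second
    using tridiagonal_decomposition.endo_trace_E_0_E'_0[OF swap assms(2)]
    by (simp add: endo_trace_scale del: o_apply)
qed

text \<open>The second trace quotient is literally the first quotient of the swapped system.\<close>

lemma split_value_swap:
  assumes "i \<le> d" "rank_one_projection (E 0)"
  shows "split_value i = (\<Prod>h=1..i. \<theta> 0 - \<theta> h) * endo_trace (poly_endo (tau \<theta>' i) A' \<circ> E 0)"
  using split_value_eq_endo_trace_quotients(2)[OF assms]
    tridiagonal_decomposition.split_value_eq_endo_trace_quotients(1)
      [OF swap assms(1) rank_one_E'_0[OF assms(2)]]
  by simp

section \<open>The split sequence as a sequence of eigenvalues\<close>

lemma split_space_0: "split_space d E E' 0 = range (E' 0)"
proof -
  interpret E'0: Vector_Spaces.linear scale scale "E' 0"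
    by (rule dual.linear_E) simp
  have "subspace (range (E' 0))"
    by (rule E'0.subspace_image[OF subspace_UNIV])
  then have span_range: "span (\<Union>h\<in>{0..0}. range (E' h)) = range (E' 0)" by simp
  have "v \<in> span (\<Union>h\<in>{0..d}. range (E h))" for v
  proof -
    have "(\<Sum>h\<le>d. E h v) \<in> span (\<Union>h\<in>{0..d}. range (E h))"
    proof (intro span_sum span_base)
      fix h assume "h \<in> {..d}"
      then show "E h v \<in> (\<Union>h\<in>{0..d}. range (E h))" by (intro UN_I[of h]) auto
    qed
    then show ?thesis by (simp add: sum_E)
  qed
  then have "span (\<Union>h\<in>{0..d}. range (E h)) = UNIV" by (rule UNIV_eq_I[symmetric])
  with span_range show ?thesis by (simp only: split_space_def Int_UNIV_right)
qed

lemma eigenvalue_on_split_product: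
  assumes "i \<le> d" "rank_one_projection (E' 0)"
  shows "eigenvalue_on (shift_prod A' \<theta>' [1..<Suc i] \<circ> shift_prod A \<theta> (rev [0..<i]))
    (split_space d E E' 0) = split_value i"
proof -
  from E'_0_nonzero obtain w where "E' 0 w \<noteq> 0" by blast
  then show ?thesis
  proof (intro eigenvalue_on_eqI[where w = "E' 0 w"])
    fix v assume "v \<in> split_space d E E' 0"
    then obtain x where v: "v = E' 0 x" by (auto simp: split_space_0)
    have "shift_prod A \<theta> (rev [0..<i]) v = poly_endo (tau \<theta> i) A v"
      by (simp add: shift_prod_eq_poly_endo tau_def atLeast0LessThan)
    moreover have "shift_prod A' \<theta>' [1..<Suc i] y =
        poly_endo (\<Prod>h=1..i. [:- \<theta>' h, 1:]) A' y" for y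
      by (simp only: dual.shift_prod_eq_poly_endo[OF distinct_upt] set_upt
          atLeastLessThanSuc_atLeastAtMost)
    ultimately show "(shift_prod A' \<theta>' [1..<Suc i] \<circ> shift_prod A \<theta> (rev [0..<i])) v =
        split_value i *s v"
      using split_product_E'_0[OF assms(1) split_value_compression[OF assms(2)]]
      by (simp only: o_apply v)
  qed (auto simp: split_space_0)
qed

end

section \<open>Tridiagonal systems\<close>

context finite_dimensional_vector_space
begin

text \<open>Orthogonality comes from matching each idempotent with its own eigenspace; completeness
  holds because the sum fixes every eigenvector and these span the space.\<close>

lemma spectral_resolution_primitive_idempotents:
  assumes A: "Vector_Spaces.linear scale scale A" "diagonalizable A"
    and E: "bij_betw E {..d} (primitive_idempotents A)"
    and R: "bij_betw (\<lambda>i. range (E i)) {..d} (eigenspaces A)"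
  shows "spectral_resolution scale Basis d A E (eigenvalue_seq A E)"
proof -
  have span_UNIV: "span (\<Union>(eigenspaces A)) = UNIV"
    using A(2) by (simp add: diagonalizable_def)
  have idem: "Vector_Spaces.linear scale scale (E i) \<and> (\<forall>v. E i (E i v) = E i v) \<and>
      (\<forall>j\<le>d. j \<noteq> i \<longrightarrow> (\<forall>v. E i (E j v) = 0))" if i: "i \<le> d" for i
  proof -
    have "E i \<in> primitive_idempotents A" using bij_betwE[OF E] i by simp
    then obtain W where lin: "Vector_Spaces.linear scale scale (E i)" and W: "W \<in> eigenspaces A"
      and "\<forall>v\<in>W. E i v = v" and "\<forall>W'\<in>eigenspaces A - {W}. \<forall>v\<in>W'. E i v = 0"
      unfolding primitive_idempotents_def mem_Collect_eq by (elim conjE bexE)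
    then have id: "\<And>v. v \<in> W \<Longrightarrow> E i v = v"
      and zero: "\<And>W' v. W' \<in> eigenspaces A \<Longrightarrow> W' \<noteq> W \<Longrightarrow> v \<in> W' \<Longrightarrow> E i v = 0"
      by simp_all
    interpret Ei: Vector_Spaces.linear scale scale "E i" by (rule lin)
    have "subspace W" using W subspace_eigenspace[OF A(1)] by (auto simp: eigenspaces_def)
    have "range (E i) = span (E i ` \<Union>(eigenspaces A))"
      by (simp only: Ei.span_image span_UNIV)
    also have "\<dots> \<subseteq> W"
    proof (rule span_minimal[OF _ \<open>subspace W\<close>], rule image_subsetI)
      fix v assume "v \<in> \<Union>(eigenspaces A)"
      then obtain W' where "W' \<in> eigenspaces A" "v \<in> W'" ..
      then show "E i v \<in> W"
        using id[of v] zero[of W' v] subspace_0[OF \<open>subspace W\<close>] by (cases "W' = W") simp_all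
    qed
    finally have "range (E i) \<subseteq> W" .
    moreover have "W \<subseteq> range (E i)"
    proof
      fix v assume "v \<in> W"
      then have "v = E i v" by (simp only: id)
      then show "v \<in> range (E i)" by (rule range_eqI)
    qed
    \<comment> \<open>Once \<open>W\<close> is identified with the range, injectivity of the
      ordering places \<open>range (E j)\<close> in a different eigenspace, which \<open>E i\<close>
      kills.\<close>
    ultimately have range: "range (E i) = W" by (rule subset_antisym)
    have "E i (E j v) = 0" if "j \<le> d" "j \<noteq> i" for j v
    proof (rule zero[of "range (E j)"])
      show "range (E j) \<in> eigenspaces A" using bij_betwE[OF R] that by simp
      show "range (E j) \<noteq> W"
        using inj_onD[OF bij_betw_imp_inj_on[OF R], of j i] that i range by auto
    qed simp
    moreover have "E i (E i v) = E i v" for v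
      by (rule id) (simp flip: range)
    ultimately show ?thesis using lin by blast
  qed
  show ?thesis
  proof (intro spectral_resolution.intro spectral_resolution_axioms.intro)
    show "finite_dimensional_vector_space scale Basis" by (rule finite_dimensional_vector_space_axioms)
    show "Vector_Spaces.linear scale scale A" by (rule A(1))
    show "Vector_Spaces.linear scale scale (E i)" if "i \<le> d" for i
      using idem that by blast
    show EE: "E i (E j v) = (if i = j then E i v else 0)" if "i \<le> d" "j \<le> d" for i j v
      using idem that by simp
    show "(\<Sum>i\<le>d. E i v) = v" for v
    proof -
      interpret vector_space_pair scale scale ..
      have "Vector_Spaces.linear scale scale (\<lambda>v. \<Sum>i\<le>d. E i v)"
        using idem by (intro linear_compose_sum) auto
      moreover have "(\<Sum>i\<le>d. E i v) = v" if "v \<in> \<Union>(eigenspaces A)" for v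
      proof -
        from that obtain j x where j: "j \<le> d" "v = E j x"
          unfolding bij_betw_imp_surj_on[OF R, symmetric] by blast
        have "(\<Sum>i\<le>d. E i v) = (\<Sum>i\<le>d. if i = j then E j x else 0)"
          unfolding j(2) by (intro sum.cong refl) (use EE j(1) in simp)
        also have "\<dots> = v" using j by simp
        finally show ?thesis .
      qed
      ultimately show ?thesis
        using linear_eq_on_span[of "\<lambda>v. \<Sum>i\<le>d. E i v" "\<lambda>v. v" "\<Union>(eigenspaces A)" v]
          linear_ident span_UNIV by blast
    qed
    show "A (E i v) = eigenvalue_seq A E i *s E i v" if "i \<le> d" for i v
    proof -
      have "range (E i) \<in> eigenspaces A" using bij_betwE[OF R] that by simp
      then obtain t where t: "range (E i) = eigenspace A t" "eigenspace A t \<noteq> {0}"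
        by (auto simp: eigenspaces_def)
      moreover obtain w where "w \<in> eigenspace A t" "w \<noteq> 0"
        using subspace_0[OF subspace_eigenspace[OF A(1)]] t(2) by blast
      ultimately have "eigenvalue_seq A E i = t"
        unfolding eigenvalue_seq_def
        by (intro eigenvalue_on_eqI[where w = w]) (auto simp: eigenspace_def)
      moreover have "E i v \<in> eigenspace A t" using t(1) by blast
      ultimately show ?thesis by (simp add: eigenspace_def)
    qed
  qed
qed

lemma idempotent_tridiagonal:
  assumes "spectral_resolution scale Basis d A E \<theta>" "standard_ordering A B d (\<lambda>i. range (E i))"
    and "i \<le> d" "j \<le> d" "i + 1 < j \<or> j + 1 < i"
  shows "E i (B (E j v)) = 0"
proof -
  interpret spectral_resolution scale Basis d A E \<theta> by fact
  interpret Ei: Vector_Spaces.linear scale scale "E i" using assms(3) by (rule linear_E)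
  let ?S = "\<Union>k\<in>{k. k \<le> d \<and> j \<le> k + 1 \<and> k \<le> j + 1}. range (E k)"
  have "B (E j v) \<in> span ?S"
    using assms(2,4) unfolding standard_ordering_def by blast
  moreover have "E i x = 0" if "x \<in> ?S" for x
    using that assms(3,5) by (auto simp: E_E)
  ultimately show ?thesis using Ei.eq_0_on_span by blast
qed

lemma tridiagonal_decomposition_tridiagonal_system:
  assumes "tridiagonal_system d A E A' E'"
  shows "tridiagonal_decomposition scale Basis d A E A' E'
    (eigenvalue_seq A E) (eigenvalue_seq A' E')"
proof -
  from assms have pair: "tridiagonal_pair A A'"
    and E: "bij_betw E {..d} (primitive_idempotents A)"
    and E': "bij_betw E' {..d} (primitive_idempotents A')"
    and so: "standard_ordering A A' d (\<lambda>i. range (E i))"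
    and so': "standard_ordering A' A d (\<lambda>i. range (E' i))"
    by (auto simp: tridiagonal_system_def)
  have R: "bij_betw (\<lambda>i. range (E i)) {..d} (eigenspaces A)"
    and R': "bij_betw (\<lambda>i. range (E' i)) {..d} (eigenspaces A')"
    using so so' by (auto simp: standard_ordering_def)
  have S: "spectral_resolution scale Basis d A E (eigenvalue_seq A E)"
    using pair E R
    by (intro spectral_resolution_primitive_idempotents) (auto simp: tridiagonal_pair_def)
  have S': "spectral_resolution scale Basis d A' E' (eigenvalue_seq A' E')"
    using pair E' R'
    by (intro spectral_resolution_primitive_idempotents) (auto simp: tridiagonal_pair_def)
  have "range (E 0) \<in> eigenspaces A" "range (E' 0) \<in> eigenspaces A'"
    using bij_betwE[OF R] bij_betwE[OF R'] by simp_all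
  then have "range (E 0) \<noteq> {0}" "range (E' 0) \<noteq> {0}"
    unfolding eigenspaces_def by blast+
  then have "\<exists>v. E 0 v \<noteq> 0" "\<exists>v. E' 0 v \<noteq> 0" by auto
  moreover have "W = {0} \<or> W = UNIV" if "subspace W" "A ` W \<subseteq> W" "A' ` W \<subseteq> W" for W
    using pair that unfolding tridiagonal_pair_def by blast
  ultimately show ?thesis
    using idempotent_tridiagonal[OF S so] idempotent_tridiagonal[OF S' so']
    by (intro tridiagonal_decomposition.intro tridiagonal_decomposition_axioms.intro S S')
qed

end

theorem theorem7p5:
  fixes scale :: "'k::field \<Rightarrow> 'v::ab_group_add \<Rightarrow> 'v"
    and Basis :: "'v set"
    and d :: nat
    and A A' :: "'v \<Rightarrow> 'v"
    and E E' :: "nat \<Rightarrow> 'v \<Rightarrow> 'v"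
    and \<theta> \<theta>' \<zeta> :: "nat \<Rightarrow> 'k"
    and tr :: "('v \<Rightarrow> 'v) \<Rightarrow> 'k"
    and ev :: "'k poly \<Rightarrow> ('v \<Rightarrow> 'v) \<Rightarrow> 'v \<Rightarrow> 'v"
  defines "tr \<equiv> finite_dimensional_vector_space.endo_trace scale Basis"
    and "ev \<equiv> finite_dimensional_vector_space.poly_endo scale"
  assumes "finite_dimensional_vector_space scale Basis"
    and "vector_space.dim scale (UNIV :: 'v set) > 0"
    and "finite_dimensional_vector_space.tridiagonal_system scale d A E A' E'"
    and "finite_dimensional_vector_space.sharp scale E"
    and "\<theta> = finite_dimensional_vector_space.eigenvalue_seq scale A E"
    and "\<theta>' = finite_dimensional_vector_space.eigenvalue_seq scale A' E'"
    and "\<zeta> = finite_dimensional_vector_space.split_seq scale d A E A' E'"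
  shows "(\<forall>i\<le>d.
            \<zeta> i = (\<Prod>h=1..i. \<theta>' 0 - \<theta>' h) * tr (ev (tau \<theta> i) A \<circ> E' 0) \<and>
            \<zeta> i = (\<Prod>h=1..i. \<theta> 0 - \<theta> h) * tr (ev (tau \<theta>' i) A' \<circ> E 0)) \<and>
         (\<forall>i\<le>d.
            \<zeta> i = tr (E 0 \<circ> ev (tau \<theta>' i) A' \<circ> ev (tau \<theta> i) A \<circ> E' 0) / tr (E 0 \<circ> E' 0) \<and>
            \<zeta> i = tr (E' 0 \<circ> ev (tau \<theta> i) A \<circ> ev (tau \<theta>' i) A' \<circ> E 0) / tr (E' 0 \<circ> E 0))"
proof -
  interpret finite_dimensional_vector_space scale Basis by fact
  interpret tridiagonal_decomposition scale Basis d A E A' E' \<theta> \<theta>'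
    unfolding assms(7,8) by (rule tridiagonal_decomposition_tridiagonal_system) fact
  have lin: "Vector_Spaces.linear scale scale (E 0)" by (rule linear_E) simp
  then interpret E0: Vector_Spaces.linear scale scale "E 0" .
  have "dim (range (E 0)) = 1" using assms(6) by (simp add: sharp_def)
  moreover have "subspace (range (E 0))" by (rule E0.subspace_image[OF subspace_UNIV])
  ultimately obtain u where u: "u \<noteq> 0" "u \<in> range (E 0)"
      "\<And>w. w \<in> range (E 0) \<Longrightarrow> \<exists>c. w = scale c u"
    using dim_1_generator by metis
  \<comment> \<open>Sharpness supplies the generator \<open>u\<close>, which \<open>E 0\<close>
    fixes because it is idempotent.\<close>
  have r: "rank_one_projection (E 0)"
    using u lin by (intro rank_one_projectionI[of _ u]) (auto simp: E_E)
  have "\<zeta> i = split_value i" if "i \<le> d" for i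
    using eigenvalue_on_split_product[OF that rank_one_E'_0[OF r]]
    unfolding assms(9) split_seq_def assms(7,8)[symmetric] by simp
  then show ?thesis
    unfolding tr_def ev_def
    using split_value_eq_endo_trace_quotients[OF _ r] split_value_swap[OF _ r] by simp
qed

end
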